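(* Let $\mathcal I_1,\mathcal I_+$ be two nonempty disjoint index sets with union $\{1,\dots,N\}$, $N\ge3$, and let $\mathcal P=\mathbb R_{\mathcal I_1}\times(\mathbb R_+)_{\mathcal I_+}$. Let $A\in\mathbb R^{m\times N}$ have unit columns and let $\mathcal S=\{1,2\}$ with $1\in\mathcal I_1$ and $2\in\mathcal I_+$. Every vector $x\in\mathcal P$ with $\mathrm{supp}(x)=\mathcal S$ is recovered from $y=Ax$ via constrained matching pursuit on $\mathcal P$ if and only if the following conditions hold: (i) $A_{\bullet\mathcal S}$ has full column rank, or equivalently $|\vartheta_{12}|<1$; (ii) for all $(z_1,z_2)^T\in(\mathbb R\setminus\{0\})\times\mathbb R_{++}$, $$\max\big(|z_1+\vartheta_{12}z_2|,\,(\vartheta_{12}z_1+z_2)_+\big)>\max\Big(\max_{j\in\mathcal S^c\cap\mathcal I_1}|\vartheta_{j1}z_1+\vartheta_{j2}z_2|,\ \max_{j\in\mathcal S^c\cap\mathcal I_+}(\vartheta_{j1}z_1+\vartheta_{j2}z_2)_+\Big);$$ (iii) $$1-\vartheta_{12}^2>\max\Big(\max_{j\in\mathcal S^c\cap\mathcal I_1}|\vartheta_{j2}-\vartheta_{12}\vartheta_{j1}|,\ \max_{j\in\mathcal S^c\cap\mathcal I_+}(\vartheta_{j2}-\vartheta_{12}\vartheta_{j1})_+,\ \max_{j\in\mathcal S^c}|\vartheta_{j1}-\vartheta_{12}\vartheta_{j2}|\Big).$$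
   Context: $\mathcal P=\{x\in\mathbb R^N: x_i\ge0\ \forall i\in\mathcal I_+\}$ (coordinates in $\mathcal I_1$ are free). Unit columns: $\|A_{\bullet i}\|_2=1$ for all $i$, where $A_{\bullet i}$ is the $i$th column; $A_{\bullet\mathcal S}$ is the submatrix of columns indexed by $\mathcal S$. $\vartheta_{ij}:=\langle A_{\bullet i},A_{\bullet j}\rangle$. $a_+=\max(a,0)$; $\mathbb R_{++}=(0,\infty)$. $\mathrm{supp}(x)=\{i:x_i\ne0\}$; $\mathcal S^c=\{1,\dots,N\}\setminus\mathcal S$; $\mathbf e_j$ is the $j$th standard basis vector. Maxima over empty index sets are omitted. Constrained matching pursuit on $\mathcal P$ with input $y$: $x^0=0$, $\mathcal J_0=\emptyset$; for $k=0,1,\dots$: let $g^*_j=\min\{\|y-A(x^k+t\mathbf e_j)\|_2^2:t\in\mathbb R,\ x^k+t\mathbf e_j\in\mathcal P\}$ for each $j$; choose any $j^*_{k+1}$ minimizing $g^*_j$ over $j\in\{1,\dots,N\}$; set $\mathcal J_{k+1}=\mathcal J_k\cup\{j^*_{k+1}\}$; choose any $x^{k+1}$ minimizing $\|Aw-y\|_2^2$ over $w\in\mathcal P$ with $\mathrm{supp}(w)\subseteq\mathcal J_{k+1}$. Several sequences may be generated due to non-unique choices. "$z$ is recovered" (exact vector recovery of $z$) means: with $y=Az$, along every generated sequence there is an $s$ with $\mathcal J_s=\mathrm{supp}(z)$, and along every sequence, once $\mathcal J_s=\mathrm{supp}(z)$ is reached, the minimization problem defining $x^s$ has the unique solution $x^s=z$.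 *)

theory Defs
  imports "HOL-Analysis.Analysis"
begin

text \<open>
  Vectors of dimension N are elements of \<open>real ^ 'n\<close> with \<open>N = CARD('n)\<close>; the elements of the
  finite type \<open>'n\<close> play the role of the indices 1, ..., N.
\<close>

definition supp :: "real ^ 'n \<Rightarrow> 'n set" where
  "supp x = {i. x $ i \<noteq> 0}"

text \<open>Coordinates outside \<open>Ip\<close> are free.\<close>

definition partial_orthant :: "'n set \<Rightarrow> (real ^ 'n) set" where
  "partial_orthant Ip = {x. \<forall>i\<in>Ip. 0 \<le> x $ i}"

definition column_product :: "real ^ 'n ^ 'm \<Rightarrow> 'n \<Rightarrow> 'n \<Rightarrow> real" where
  "column_product A i j = column i A \<bullet> column j A"

text \<open>The two-column submatrix of \<open>A\<close> with columns indexed by \<open>i\<close> and \<open>j\<close>.\<close>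

definition column_pair :: "real ^ 'n ^ 'm \<Rightarrow> 'n \<Rightarrow> 'n \<Rightarrow> real ^ 2 ^ 'm" where
  "column_pair A i j = (\<chi> r. vector [A $ r $ i, A $ r $ j])"

text \<open>Maximum of several maxima, in which maxima over empty sets are omitted.\<close>

definition Max_of_Maxes :: "real set set \<Rightarrow> real" where
  "Max_of_Maxes F = Max {Max X | X. X \<in> F \<and> X \<noteq> {}}"

text \<open>
  The optimal value of the one-dimensional problem along the \<open>j\<close>-th coordinate. When \<open>P\<close> is a
  partial orthant, \<open>x \<in> P\<close> and \<open>column j A\<close> is nonzero, this is a convex quadratic minimized over
  a nonempty closed interval, so the infimum is a minimum.
\<close>

definition coord_opt :: "(real ^ 'n) set \<Rightarrow> real ^ 'n ^ 'm \<Rightarrow> real ^ 'm \<Rightarrow> real ^ 'n \<Rightarrow> 'n \<Rightarrow> real" where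
  "coord_opt P A y x j =
     Inf {(norm (y - A *v (x + t *\<^sub>R axis j 1)))\<^sup>2 | t. x + t *\<^sub>R axis j 1 \<in> P}"

definition restricted_minimizers ::
    "(real ^ 'n) set \<Rightarrow> real ^ 'n ^ 'm \<Rightarrow> real ^ 'm \<Rightarrow> 'n set \<Rightarrow> (real ^ 'n) set" where
  "restricted_minimizers P A y J =
     {x. is_arg_min (\<lambda>w. (norm (A *v w - y))\<^sup>2) (\<lambda>w. w \<in> P \<and> supp w \<subseteq> J) x}"

text \<open>
  \<open>cmp_run P A y x J\<close>: the iterates \<open>x\<close> and index sets \<open>J\<close> can be generated by constrained matching
  pursuit on \<open>P\<close> with input \<open>y\<close>, for some resolution of the non-unique choices.
\<close>

definition cmp_run ::
    "(real ^ 'n) set \<Rightarrow> real ^ 'n ^ 'm \<Rightarrow> real ^ 'm \<Rightarrow> (nat \<Rightarrow> real ^ 'n) \<Rightarrow> (nat \<Rightarrow> 'n set) \<Rightarrow> bool" where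
  "cmp_run P A y x J \<longleftrightarrow>
     x 0 = 0 \<and> J 0 = {} \<and>
     (\<forall>k. (\<exists>j. is_arg_min (coord_opt P A y (x k)) (\<lambda>_. True) j \<and> J (Suc k) = J k \<union> {j}) \<and>
          x (Suc k) \<in> restricted_minimizers P A y (J (Suc k)))"

definition cmp_recovers :: "(real ^ 'n) set \<Rightarrow> real ^ 'n ^ 'm \<Rightarrow> real ^ 'n \<Rightarrow> bool" where
  "cmp_recovers P A z \<longleftrightarrow>
     (\<forall>x J. cmp_run P A (A *v z) x J \<longrightarrow>
        (\<exists>s. J s = supp z) \<and>
        (\<forall>s. J s = supp z \<longrightarrow> restricted_minimizers P A (A *v z) (J s) = {z} \<and> x s = z))"

end

theory Submission
  imports Defs
begin

text \<open>
  Let \<open>r\<close> be the current residual. Along a coordinate \<open>j\<close> on which the iterate vanishes, or whose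
  column is orthogonal to \<open>r\<close>, the optimal decrease of the objective is the square of the gain
  \<open>\<bar>\<langle>r, A\<^sub>j\<rangle>\<bar>\<close> (free coordinate) or \<open>\<langle>r, A\<^sub>j\<rangle>\<^sub>+\<close> (nonnegative coordinate). Every iterate that
  matters here is of this kind, so, given the full column rank (i) that makes the last minimizer
  unique, pursuit recovers a vector with support \<open>{1, 2}\<close> iff the maximal gain is attained only
  inside \<open>{1, 2}\<close> at each of the first two steps. For the first step this is
  (ii). After choosing 1 the residual is \<open>z\<^sub>2 (A\<^sub>2 - \<theta> A\<^sub>1)\<close>, after choosing 2 it is
  \<open>z\<^sub>1 (A\<^sub>1 - \<theta> A\<^sub>2)\<close>; both signs of \<open>z\<^sub>1\<close> occur, and either index can be made to win
  the first step by taking the ratio of the entries extreme. This gives (iii). Failure arguments need an actual run,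
  hence the existence of minimizers over a possibly rank-deficient set of columns: these are nearest
  points of a finitely generated, therefore closed, cone.
\<close>

section \<open>Optimization along a single coordinate\<close>

text \<open>The minimizer over the feasible \<open>t\<close> of the distance of \<open>r\<close> to \<open>t\<close> times the \<open>j\<close>-th column,
  provided that this column has unit norm.\<close>

definition axis_coeff :: "'n set \<Rightarrow> real ^ 'n ^ 'm \<Rightarrow> real ^ 'm \<Rightarrow> 'n \<Rightarrow> real" where
  "axis_coeff Ip A r j =
     (if j \<in> Ip then max (r \<bullet> column j A) 0 else r \<bullet> column j A)"

lemma norm_diff_scaled_unit_square:
  fixes r a :: "'a :: real_inner"
  assumes "norm a = 1"
  shows "(norm (r - t *\<^sub>R a))\<^sup>2 = (norm r)\<^sup>2 - (r \<bullet> a)\<^sup>2 + (t - r \<bullet> a)\<^sup>2"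
proof -
  have "a \<bullet> a = 1"
    using assms by (simp flip: power2_norm_eq_inner)
  then show ?thesis
    unfolding power2_norm_eq_inner
    by (simp add: inner_diff inner_commute power2_eq_square algebra_simps)
qed

lemma matrix_vector_mult_axis:
  fixes A :: "real ^ 'n ^ 'm"
  shows "A *v (t *\<^sub>R axis j 1) = t *\<^sub>R column j A"
  by (simp add: matrix_vector_mult_scaleR matrix_vector_mult_basis)

lemma residual_add_axis:
  fixes A :: "real ^ 'n ^ 'm"
  shows "y - A *v (x + t *\<^sub>R axis j 1) = (y - A *v x) - t *\<^sub>R column j A"
  by (simp add: matrix_vector_right_distrib matrix_vector_mult_axis)

lemma add_axis_in_partial_orthant:
  assumes "x \<in> partial_orthant Ip"
  shows "x + t *\<^sub>R axis j 1 \<in> partial_orthant Ip \<longleftrightarrow> (j \<in> Ip \<longrightarrow> 0 \<le> x $ j + t)"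
  using assms by (auto simp: partial_orthant_def axis_def)

text \<open>After completing the square, the optimum is the feasible \<open>t\<close> nearest to
  \<open>s\<close>. For \<open>j \<in> Ip\<close> the feasible \<open>t\<close> start at
  \<open>- x $ j\<close>, so clipping at 0 would give the wrong point if
  \<open>s < 0 < x $ j\<close>; \<open>orth\<close> excludes this situation.\<close>

lemma coord_opt_partial_orthant:
  fixes A :: "real ^ 'n ^ 'm"
  assumes x: "x \<in> partial_orthant Ip" and unit: "norm (column j A) = 1"
    and orth: "x $ j = 0 \<or> (y - A *v x) \<bullet> column j A = 0"
  shows "coord_opt (partial_orthant Ip) A y x j =
    (norm (y - A *v x))\<^sup>2 - (axis_coeff Ip A (y - A *v x) j)\<^sup>2"
proof -
  define r where "r = y - A *v x"
  define s where "s = r \<bullet> column j A"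
  define c where "c = axis_coeff Ip A r j"
  have c: "c = (if j \<in> Ip then max s 0 else s)"
    by (simp add: c_def axis_coeff_def s_def)
  have eq: "(norm (y - A *v (x + t *\<^sub>R axis j 1)))\<^sup>2 = (norm r)\<^sup>2 - s\<^sup>2 + (t - s)\<^sup>2" for t
    unfolding residual_add_axis by (simp add: norm_diff_scaled_unit_square[OF unit] r_def s_def)
  have xj: "j \<in> Ip \<Longrightarrow> 0 \<le> x $ j"
    using x by (simp add: partial_orthant_def)
  show ?thesis
    unfolding coord_opt_def r_def[symmetric] c_def[symmetric] eq add_axis_in_partial_orthant[OF x]
  proof (rule cInf_eq_minimum)
    \<comment> \<open>\<open>c\<close> is \<open>s\<close> or 0, hence
      \<open>c * (c - s) = 0\<close>.\<close>
    have "(norm r)\<^sup>2 - c\<^sup>2 = (norm r)\<^sup>2 - s\<^sup>2 + (c - s)\<^sup>2"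
      by (auto simp: c max_def)
    moreover have "j \<in> Ip \<longrightarrow> 0 \<le> x $ j + c"
      using xj by (simp add: c)
    ultimately show "(norm r)\<^sup>2 - c\<^sup>2 \<in>
        {(norm r)\<^sup>2 - s\<^sup>2 + (t - s)\<^sup>2 |t. j \<in> Ip \<longrightarrow> 0 \<le> x $ j + t}"
      by blast
  next
    fix v
    assume "v \<in> {(norm r)\<^sup>2 - s\<^sup>2 + (t - s)\<^sup>2 |t. j \<in> Ip \<longrightarrow> 0 \<le> x $ j + t}"
    then obtain t where v: "v = (norm r)\<^sup>2 - s\<^sup>2 + (t - s)\<^sup>2" and t: "j \<in> Ip \<Longrightarrow> 0 \<le> x $ j + t"
      by blast
    show "(norm r)\<^sup>2 - c\<^sup>2 \<le> v"
    proof (cases "j \<in> Ip \<and> s < 0")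
      case True
      then have "0 \<le> t"
        using orth t by (simp add: r_def s_def)
      then have "s\<^sup>2 \<le> (t - s)\<^sup>2"
        using True by (intro power2_le_iff_abs_le[THEN iffD2]) auto
      then show ?thesis
        using True by (simp add: v c)
    next
      case False
      then have "c = s"
        by (auto simp: c)
      then show ?thesis
        by (simp add: v)
    qed
  qed
qed

lemma is_arg_min_coord_opt:
  fixes A :: "real ^ 'n ^ 'm"
  assumes "x \<in> partial_orthant Ip" and "\<And>j. norm (column j A) = 1"
    and "\<And>j. x $ j = 0 \<or> (y - A *v x) \<bullet> column j A = 0"
  shows "is_arg_min (coord_opt (partial_orthant Ip) A y x) (\<lambda>_. True) j \<longleftrightarrow>
    (\<forall>k. \<bar>axis_coeff Ip A (y - A *v x) k\<bar> \<le> \<bar>axis_coeff Ip A (y - A *v x) j\<bar>)"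
  by (simp add: is_arg_min_linorder coord_opt_partial_orthant assms abs_le_square_iff)

text \<open>The coefficient is the projection of \<open>y \<bullet> column j A\<close> onto the
  feasible interval, and the objective grows quadratically away from it. By this uniqueness the
  first choice determines the first iterate.\<close>

lemma restricted_minimizers_singleton:
  fixes A :: "real ^ 'n ^ 'm"
  assumes unit: "norm (column j A) = 1"
  shows "restricted_minimizers (partial_orthant Ip) A y {j} =
    {axis_coeff Ip A y j *\<^sub>R axis j 1}"
proof -
  define s where "s = y \<bullet> column j A"
  define c where "c = axis_coeff Ip A y j"
  define f where "f = (\<lambda>w. (norm (A *v w - y))\<^sup>2)"
  define F where "F = (\<lambda>w. w \<in> partial_orthant Ip \<and> supp w \<subseteq> {j})"
  have c: "c = (if j \<in> Ip then max s 0 else s)"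
    by (simp add: c_def axis_coeff_def s_def)
  have f_axis: "f (t *\<^sub>R axis j 1) = (norm y)\<^sup>2 - s\<^sup>2 + (t - s)\<^sup>2" for t
    using norm_diff_scaled_unit_square[OF unit, of y t]
    by (simp add: f_def matrix_vector_mult_axis s_def norm_minus_commute)
  have Fc: "F (c *\<^sub>R axis j 1)"
    by (auto simp: F_def c partial_orthant_def supp_def axis_def)
  have w_eq: "w = w $ j *\<^sub>R axis j 1" if "F w" for w
    using that by (auto simp: F_def supp_def vec_eq_iff axis_def)
  have gap: "f (c *\<^sub>R axis j 1) + (w $ j - c)\<^sup>2 \<le> f w" if "F w" for w
  proof -
    \<comment> \<open>The obtuse-angle property of the projection: either \<open>c = s\<close>, or
      \<open>c = 0\<close> with \<open>s < 0 \<le> w $ j\<close>.\<close>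
    have "0 \<le> (w $ j - c) * (c - s)"
      using that by (auto simp: c F_def partial_orthant_def max_def mult_nonneg_nonpos)
    then have "(c - s)\<^sup>2 + (w $ j - c)\<^sup>2 \<le> (w $ j - s)\<^sup>2"
      by (simp add: power2_eq_square algebra_simps)
    then show ?thesis
      by (subst (2) w_eq[OF that]) (simp add: f_axis)
  qed
  have "is_arg_min f F w \<longleftrightarrow> w = c *\<^sub>R axis j 1" for w
  proof
    assume "is_arg_min f F w"
    then have "F w" "f w \<le> f (c *\<^sub>R axis j 1)"
      using Fc by (auto simp: is_arg_min_linorder)
    with gap[of w] have "(w $ j - c)\<^sup>2 \<le> 0"
      by linarith
    with w_eq[OF \<open>F w\<close>] show "w = c *\<^sub>R axis j 1"
      by simp
  next
    assume w: "w = c *\<^sub>R axis j 1"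
    have "f w \<le> f v" if "F v" for v
      using gap[OF that] zero_le_power2[of "v $ j - c"] unfolding w by linarith
    with Fc w show "is_arg_min f F w"
      by (auto simp: is_arg_min_linorder)
  qed
  then show ?thesis
    by (auto simp: restricted_minimizers_def f_def F_def c_def)
qed

text \<open>A nonzero coefficient has not been clipped, so the residual is orthogonal to the chosen
  column; all other coordinates of the iterate vanish. Thus \<open>is_arg_min_coord_opt\<close>
  applies at the second step as well.\<close>

lemma axis_minimizer_orthogonal:
  fixes A :: "real ^ 'n ^ 'm" and Ip :: "'n set" and y :: "real ^ 'm"
  assumes "norm (column j A) = 1"
  defines "x \<equiv> axis_coeff Ip A y j *\<^sub>R axis j 1"
  shows "x $ k = 0 \<or> (y - A *v x) \<bullet> column k A = 0"
proof (cases "k = j \<and> axis_coeff Ip A y j \<noteq> 0")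
  case True
  then have "axis_coeff Ip A y j = y \<bullet> column j A"
    by (auto simp: axis_coeff_def max_def split: if_splits)
  moreover have "column j A \<bullet> column j A = 1"
    using assms(1) by (simp flip: power2_norm_eq_inner)
  ultimately show ?thesis
    using True by (simp add: x_def matrix_vector_mult_axis inner_diff_left)
qed (auto simp: x_def axis_def)

section \<open>Existence of minimizers for a prescribed support\<close>

lemma convex_cone_partial_orthant_supp:
  "convex_cone {w \<in> partial_orthant Ip. supp w \<subseteq> J}"
  unfolding convex_cone_iff by (fastforce simp: partial_orthant_def supp_def)

lemma convex_cone_hull_sum:
  assumes "\<And>i. i \<in> I \<Longrightarrow> f i \<in> convex_cone hull G"
  shows "sum f I \<in> convex_cone hull G"
  using assms
  by (induction I rule: infinite_finite_induct)
    (auto simp: convex_cone_hull_contains_0 convex_cone_hull_add)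

text \<open>A free coordinate contributes its column with both signs as generators, a nonnegative
  one only the column itself. Finiteness of the generating set makes the image closed even when the
  columns are dependent.\<close>

lemma image_partial_orthant_supp:
  fixes A :: "real ^ 'n ^ 'm"
  shows "(*v) A ` {w \<in> partial_orthant Ip. supp w \<subseteq> J} =
    convex_cone hull ((\<lambda>j. column j A) ` J \<union> (\<lambda>j. - column j A) ` (J - Ip))"
    (is "?L = convex_cone hull ?G")
proof
  show "?L \<subseteq> convex_cone hull ?G"
  proof clarify
    fix w
    assume w: "w \<in> partial_orthant Ip" "supp w \<subseteq> J"
    have "w $ j *\<^sub>R column j A \<in> convex_cone hull ?G" for j
    proof -
      consider "w $ j = 0" | "j \<in> J" "0 \<le> w $ j" | "j \<in> J - Ip" "w $ j \<le> 0"
        using w by (force simp: partial_orthant_def supp_def)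
      then show ?thesis
      proof cases
        case 3
        then have "(- w $ j) *\<^sub>R (- column j A) \<in> convex_cone hull ?G"
          by (intro convex_cone_hull_mul hull_inc) auto
        then show ?thesis
          by simp
      qed (simp_all add: convex_cone_hull_contains_0 convex_cone_hull_mul hull_inc)
    qed
    then show "A *v w \<in> convex_cone hull ?G"
      unfolding matrix_mult_sum scalar_mult_eq_scaleR by (rule convex_cone_hull_sum)
  qed
  have "A *v axis j 1 \<in> ?L" if "j \<in> J" for j
    using that by (intro imageI) (auto simp: partial_orthant_def supp_def axis_def)
  moreover have "A *v (- 1 *\<^sub>R axis j 1) \<in> ?L" if "j \<in> J - Ip" for j
    using that by (intro imageI) (auto simp: partial_orthant_def supp_def axis_def)
  ultimately have "?G \<subseteq> ?L"
    unfolding matrix_vector_mult_axis by (auto simp: matrix_vector_mult_basis)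
  then show "convex_cone hull ?G \<subseteq> ?L"
    by (intro hull_minimal) (simp_all add: convex_cone_linear_image convex_cone_partial_orthant_supp)
qed

lemma restricted_minimizers_nonempty:
  fixes A :: "real ^ 'n ^ 'm"
  shows "restricted_minimizers (partial_orthant Ip) A y J \<noteq> {}"
proof -
  let ?F = "{w \<in> partial_orthant Ip. supp w \<subseteq> J}"
  have "closed ((*v) A ` ?F)"
    unfolding image_partial_orthant_supp by (intro closed_convex_cone_hull) simp
  moreover have "(*v) A ` ?F \<noteq> {}"
    using convex_cone_nonempty[OF convex_cone_partial_orthant_supp] by blast
  ultimately obtain u where u: "u \<in> (*v) A ` ?F" "\<And>v. v \<in> (*v) A ` ?F \<Longrightarrow> dist y u \<le> dist y v"
    by (rule distance_attains_inf[where a = y]) blast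
  from u(1) obtain w where "w \<in> ?F" "u = A *v w"
    by blast
  have "norm (A *v w - y) \<le> norm (A *v v - y)" if "v \<in> ?F" for v
    using u(2)[of "A *v v"] that \<open>u = A *v w\<close> by (simp add: dist_norm norm_minus_commute[of y])
  with \<open>w \<in> ?F\<close> have "w \<in> restricted_minimizers (partial_orthant Ip) A y J"
    by (simp add: restricted_minimizers_def is_arg_min_linorder)
  then show ?thesis
    by blast
qed

section \<open>Runs of the pursuit and their first two choices\<close>

text \<open>Packing iterate and index set into one state turns a run into a chain of a relation, to
  which dependent choice applies.\<close>

definition cmp_step ::
    "(real ^ 'n) set \<Rightarrow> real ^ 'n ^ 'm \<Rightarrow> real ^ 'm \<Rightarrow>
      (real ^ 'n) \<times> 'n set \<Rightarrow> (real ^ 'n) \<times> 'n set \<Rightarrow> bool" where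
  "cmp_step P A y s s' \<longleftrightarrow>
     (\<exists>j. is_arg_min (coord_opt P A y (fst s)) (\<lambda>_. True) j \<and> snd s' = snd s \<union> {j}) \<and>
     fst s' \<in> restricted_minimizers P A y (snd s')"

lemma cmp_run_iff_step:
  "cmp_run P A y x J \<longleftrightarrow>
    x 0 = 0 \<and> J 0 = {} \<and> (\<forall>k. cmp_step P A y (x k, J k) (x (Suc k), J (Suc k)))"
  by (simp add: cmp_run_def cmp_step_def)

lemma cmp_step_total:
  fixes A :: "real ^ 'n ^ 'm"
  shows "\<exists>s'. cmp_step (partial_orthant Ip) A y s s'"
proof -
  obtain j where "is_arg_min (coord_opt (partial_orthant Ip) A y (fst s)) (\<lambda>_. True) j"
    using ex_is_arg_min_if_finite[of UNIV "coord_opt (partial_orthant Ip) A y (fst s)"] by auto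
  moreover obtain x where "x \<in> restricted_minimizers (partial_orthant Ip) A y (snd s \<union> {j})"
    using restricted_minimizers_nonempty by blast
  ultimately have "cmp_step (partial_orthant Ip) A y s (x, snd s \<union> {j})"
    by (auto simp: cmp_step_def)
  then show ?thesis ..
qed

text \<open>A failure of recovery shows within two choices, but \<open>cmp_recovers\<close> speaks
  of infinite runs. Totality of the step relation supplies a tail by dependent choice, and the
  prefix is put in front of it.\<close>

lemma cmp_run_extends:
  fixes A :: "real ^ 'n ^ 'm" and Ip :: "'n set" and y :: "real ^ 'm"
  defines "R \<equiv> cmp_step (partial_orthant Ip) A y"
  assumes "R (0, {}) (x1, J1)" and "R (x1, J1) (x2, J2)"
  obtains x J where "cmp_run (partial_orthant Ip) A y x J"
    "x (Suc 0) = x1" "J (Suc 0) = J1" "x (Suc (Suc 0)) = x2" "J (Suc (Suc 0)) = J2"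
proof -
  obtain f where f: "f 0 = (x2, J2)" "\<And>k. R (f k) (f (Suc k))"
    using dependent_nat_choice[of "\<lambda>n s. n = 0 \<longrightarrow> s = (x2, J2)" "\<lambda>_. R"] cmp_step_total
    unfolding R_def by (metis nat.distinct(1))
  define g where "g = case_nat (0, {}) (case_nat (x1, J1) f)"
  have "R (g k) (g (Suc k))" for k
    using assms(2,3) f by (auto simp: g_def split: nat.split)
  then have "cmp_run (partial_orthant Ip) A y (fst \<circ> g) (snd \<circ> g)"
    by (simp add: cmp_run_iff_step R_def) (simp add: g_def)
  then show ?thesis
    by (rule that) (simp_all add: g_def f)
qed

lemma cmp_run_mono:
  assumes "cmp_run P A y x J" and "k \<le> l"
  shows "J k \<subseteq> J l"
proof (rule lift_Suc_mono_le[OF _ assms(2)])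
  show "J n \<subseteq> J (Suc n)" for n
    using assms(1) by (auto simp: cmp_run_def)
qed

text \<open>An index set gains at most one element per step, so a support of size two appears at
  step two at the earliest, and by monotonicity it contains both early choices. Any ties may be
  resolved towards \<open>j\<close> and \<open>k\<close>, and \<open>k = j\<close> is
  allowed.\<close>

lemma cmp_recovers_first_two:
  fixes A :: "real ^ 'n ^ 'm" and Ip :: "'n set"
  defines "P \<equiv> partial_orthant Ip"
  assumes rec: "cmp_recovers P A z" and card: "card (supp z) = 2"
    and unit: "\<And>j. norm (column j A) = 1"
    and j: "is_arg_min (coord_opt P A (A *v z) 0) (\<lambda>_. True) j"
    and k: "is_arg_min (coord_opt P A (A *v z) (axis_coeff Ip A (A *v z) j *\<^sub>R axis j 1)) (\<lambda>_. True) k"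
  shows "j \<in> supp z" and "k \<in> supp z"
    and "restricted_minimizers P A (A *v z) (supp z) = {z}"
proof -
  let ?x1 = "axis_coeff Ip A (A *v z) j *\<^sub>R axis j 1"
  obtain x2 where x2: "x2 \<in> restricted_minimizers P A (A *v z) ({j} \<union> {k})"
    using restricted_minimizers_nonempty unfolding P_def by blast
  have 1: "cmp_step P A (A *v z) (0, {}) (?x1, {j})"
    using j unit by (auto simp: cmp_step_def P_def restricted_minimizers_singleton)
  have 2: "cmp_step P A (A *v z) (?x1, {j}) (x2, {j} \<union> {k})"
    using k x2 unfolding cmp_step_def by auto
  obtain x J where run: "cmp_run P A (A *v z) x J"
    and J1: "J (Suc 0) = {j}" and J2: "J (Suc (Suc 0)) = {j} \<union> {k}"
    using cmp_run_extends[OF 1[unfolded P_def] 2[unfolded P_def]] unfolding P_def by metis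
  from rec run obtain s where s: "J s = supp z"
    unfolding cmp_recovers_def P_def by blast
  have "J 0 = {}"
    using run by (simp add: cmp_run_def)
  then have "card (J 0) = 0" "card (J (Suc 0)) = 1"
    using J1 by simp_all
  then have "s \<noteq> 0" "s \<noteq> Suc 0"
    using s card by (metis zero_neq_numeral, metis one_eq_numeral_iff num.distinct(1))
  then have "J (Suc (Suc 0)) \<subseteq> supp z"
    using cmp_run_mono[OF run, of "Suc (Suc 0)" s] s by simp
  then show "j \<in> supp z" "k \<in> supp z"
    using J2 by auto
  show "restricted_minimizers P A (A *v z) (supp z) = {z}"
    using rec run s by (auto simp: cmp_recovers_def)
qed

section \<open>Rank of two unit columns, and strict bounds on maxima\<close>

text \<open>Completing the square in the Gram form of two unit columns leaves the coefficient
  \<open>1 - \<theta>\<^sup>2\<close> at the second square, so the form is definite iff this is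
  positive.\<close>

lemma rank_column_pair_iff:
  fixes A :: "real ^ 'n ^ 'm"
  assumes unit: "norm (column i A) = 1" "norm (column j A) = 1"
  shows "rank (column_pair A i j) = 2 \<longleftrightarrow> \<bar>column_product A i j\<bar> < 1"
proof -
  define \<theta> where "\<theta> = column_product A i j"
  have mult: "column_pair A i j *v w = w $ 1 *\<^sub>R column i A + w $ 2 *\<^sub>R column j A" for w
    by (simp add: vec_eq_iff matrix_vector_mult_def column_pair_def column_def sum_2)
  have nrm: "(norm (column_pair A i j *v w))\<^sup>2 = (w $ 1 + \<theta> * w $ 2)\<^sup>2 + (1 - \<theta>\<^sup>2) * (w $ 2)\<^sup>2" for w
  proof -
    have "column i A \<bullet> column i A = 1" "column j A \<bullet> column j A = 1"
      using unit by (simp_all flip: power2_norm_eq_inner)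
    then show ?thesis
      unfolding power2_norm_eq_inner
      by (simp add: mult \<theta>_def column_product_def inner_add inner_commute
          power2_eq_square algebra_simps)
  qed
  have "\<bar>\<theta>\<bar> \<le> 1"
    using Cauchy_Schwarz_ineq2[of "column i A" "column j A"] unit by (simp add: \<theta>_def column_product_def)
  have "rank (column_pair A i j) = 2 \<longleftrightarrow> (\<forall>w. column_pair A i j *v w = 0 \<longrightarrow> w = 0)"
    using full_rank_injective[of "column_pair A i j"]
      linear_injective_0[of "(*v) (column_pair A i j)"] by simp
  also have "\<dots> \<longleftrightarrow> \<bar>\<theta>\<bar> < 1"
  proof
    assume inj: "\<forall>w. column_pair A i j *v w = 0 \<longrightarrow> w = 0"
    show "\<bar>\<theta>\<bar> < 1"
    proof (rule ccontr)
      assume "\<not> \<bar>\<theta>\<bar> < 1"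
      with \<open>\<bar>\<theta>\<bar> \<le> 1\<close> have "\<theta>\<^sup>2 = 1"
        by (simp add: abs_square_eq_1)
      \<comment> \<open>For \<open>\<theta>\<^sup>2 = 1\<close> this vector annihilates both
        summands of \<open>nrm\<close>.\<close>
      then have "column_pair A i j *v vector [\<theta>, - 1] = 0"
        using nrm[of "vector [\<theta>, - 1]"] by simp
      then show False
        using inj by (fastforce simp: vec_eq_iff forall_2)
    qed
  next
    assume "\<bar>\<theta>\<bar> < 1"
    then have pos: "0 < 1 - \<theta>\<^sup>2"
      by (simp add: abs_square_less_1)
    show "\<forall>w. column_pair A i j *v w = 0 \<longrightarrow> w = 0"
    proof (intro allI impI)
      fix w :: "real ^ 2"
      assume "column_pair A i j *v w = 0"
      then have "(w $ 1 + \<theta> * w $ 2)\<^sup>2 + (1 - \<theta>\<^sup>2) * (w $ 2)\<^sup>2 = 0"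
        using nrm[of w] by simp
      moreover have "0 \<le> (1 - \<theta>\<^sup>2) * (w $ 2)\<^sup>2"
        using pos by simp
      ultimately have "(w $ 1 + \<theta> * w $ 2)\<^sup>2 = 0" "(1 - \<theta>\<^sup>2) * (w $ 2)\<^sup>2 = 0"
        using zero_le_power2[of "w $ 1 + \<theta> * w $ 2"] by linarith+
      then show "w = 0"
        using pos by (simp add: vec_eq_iff forall_2)
    qed
  qed
  finally show ?thesis
    by (simp add: \<theta>_def)
qed

text \<open>Empty members are vacuous on the right, matching their omission on the left. A nonempty
  member keeps the outer \<open>Max\<close> away from the empty set, where its value is
  unspecified.\<close>

lemma Max_of_Maxes_less_iff:
  assumes "finite F" and "\<And>X. X \<in> F \<Longrightarrow> finite X" and "\<exists>X\<in>F. X \<noteq> {}"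
  shows "Max_of_Maxes F < c \<longleftrightarrow> (\<forall>X\<in>F. \<forall>v\<in>X. v < c)"
proof -
  have eq: "{Max X |X. X \<in> F \<and> X \<noteq> {}} = Max ` {X \<in> F. X \<noteq> {}}"
    by auto
  have "Max_of_Maxes F < c \<longleftrightarrow> (\<forall>X\<in>{X \<in> F. X \<noteq> {}}. Max X < c)"
    unfolding Max_of_Maxes_def eq using assms(1,3) by (subst Max_less_iff) auto
  also have "\<dots> \<longleftrightarrow> (\<forall>X\<in>F. \<forall>v\<in>X. v < c)"
    using assms(2) by (metis (mono_tags, lifting) Max_less_iff empty_iff mem_Collect_eq)
  finally show ?thesis .
qed


text \<open>The link between choices with arbitrary tie-breaking and the strict inequalities in (ii)
  and (iii); it rests on the maximum over a finite type being attained.\<close>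

lemma argmax_in_pair_iff:
  fixes h :: "'n :: finite \<Rightarrow> real"
  shows "(\<forall>k. (\<forall>l. h l \<le> h k) \<longrightarrow> k \<in> {i, j}) \<longleftrightarrow>
    (\<forall>l\<in>- {i, j}. h l < max (h i) (h j))"
proof
  assume L: "\<forall>k. (\<forall>l. h l \<le> h k) \<longrightarrow> k \<in> {i, j}"
  obtain k where k: "\<forall>l. h l \<le> h k"
    using ex_is_arg_min_if_finite[of UNIV "\<lambda>l. - h l"] by (auto simp: is_arg_min_linorder)
  then have "h k \<le> max (h i) (h j)"
    using L by auto
  then show "\<forall>l\<in>- {i, j}. h l < max (h i) (h j)"
    using L k by (meson ComplD dual_order.trans linorder_not_le)
next
  assume R: "\<forall>l\<in>- {i, j}. h l < max (h i) (h j)"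
  show "\<forall>k. (\<forall>l. h l \<le> h k) \<longrightarrow> k \<in> {i, j}"
  proof (intro allI impI)
    fix k
    assume "\<forall>l. h l \<le> h k"
    then have "\<not> h k < max (h i) (h j)"
      by (simp add: not_less)
    with R show "k \<in> {i, j}"
      by blast
  qed
qed

section \<open>Pursuit for a support of one free and one nonnegative index\<close>

locale support_pair =
  fixes A :: "real ^ 'n ^ 'm" and Ip :: "'n set" and i1 i2 :: 'n
  assumes unit: "\<And>j. norm (column j A) = 1"
    and i1: "i1 \<notin> Ip" and i2: "i2 \<in> Ip"
begin

abbreviation "P \<equiv> partial_orthant Ip"
abbreviation "a j \<equiv> column j A"
abbreviation "\<theta> \<equiv> column_product A"

definition gain :: "real ^ 'm \<Rightarrow> 'n \<Rightarrow> real" where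
  "gain r j = \<bar>axis_coeff Ip A r j\<bar>"

definition pair :: "real \<Rightarrow> real \<Rightarrow> real ^ 'n" where
  "pair z1 z2 = z1 *\<^sub>R axis i1 1 + z2 *\<^sub>R axis i2 1"

text \<open>The residual after the first step if \<open>j\<close> is chosen, by the explicit
  minimizer over \<open>{j}\<close>.\<close>

definition resid :: "real ^ 'm \<Rightarrow> 'n \<Rightarrow> real ^ 'm" where
  "resid y j = y - axis_coeff Ip A y j *\<^sub>R a j"

lemma distinct: "i1 \<noteq> i2"
  using i1 i2 by auto

lemma inner_column_self: "a j \<bullet> a j = 1"
  using unit[of j] by (simp flip: power2_norm_eq_inner)

lemma gain_eq: "gain r j = (if j \<in> Ip then max (r \<bullet> a j) 0 else \<bar>r \<bullet> a j\<bar>)"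
  by (simp add: gain_def axis_coeff_def)

lemma gain_nonneg: "0 \<le> gain r j"
  by (simp add: gain_def)

lemma gain_le: "gain r j \<le> \<bar>r \<bullet> a j\<bar>"
  by (auto simp: gain_eq)

lemma gain_scaleR: "0 \<le> c \<Longrightarrow> gain (c *\<^sub>R r) j = c * gain r j"
  by (simp add: gain_eq abs_mult max_def mult_le_0_iff zero_le_mult_iff)

lemma matrix_mult_pair: "A *v pair z1 z2 = z1 *\<^sub>R a i1 + z2 *\<^sub>R a i2"
  by (simp add: pair_def matrix_vector_right_distrib matrix_vector_mult_axis)

lemma pair_nth: "pair z1 z2 $ j = (if j = i1 then z1 else if j = i2 then z2 else 0)"
  using distinct by (auto simp: pair_def axis_def)

lemma eq_pair:
  assumes "supp w \<subseteq> {i1, i2}"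
  shows "w = pair (w $ i1) (w $ i2)"
  using assms by (auto simp: vec_eq_iff pair_nth supp_def)

lemma pair_in_orthant: "0 \<le> z2 \<Longrightarrow> pair z1 z2 \<in> P"
  using i1 by (auto simp: partial_orthant_def pair_def axis_def)

lemma supp_pair_subset: "supp (pair z1 z2) \<subseteq> {i1, i2}"
  by (auto simp: supp_def pair_nth)

lemma supp_pair: "z1 \<noteq> 0 \<Longrightarrow> z2 \<noteq> 0 \<Longrightarrow> supp (pair z1 z2) = {i1, i2}"
  using distinct by (auto simp: supp_def pair_nth)

lemma first_choice_iff:
  "is_arg_min (coord_opt P A y 0) (\<lambda>_. True) j \<longleftrightarrow> (\<forall>k. gain y k \<le> gain y j)"
  using is_arg_min_coord_opt[of 0 Ip A y j] unit by (simp add: partial_orthant_def gain_def)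

lemma second_choice_iff:
  "is_arg_min (coord_opt P A y (axis_coeff Ip A y j *\<^sub>R axis j 1)) (\<lambda>_. True) k \<longleftrightarrow>
    (\<forall>l. gain (resid y j) l \<le> gain (resid y j) k)"
proof -
  have "axis_coeff Ip A y j *\<^sub>R axis j 1 \<in> P"
    by (auto simp: partial_orthant_def axis_coeff_def axis_def)
  from is_arg_min_coord_opt[OF this unit axis_minimizer_orthogonal[OF unit]] show ?thesis
    by (simp add: gain_def resid_def matrix_vector_mult_axis)
qed

lemma recovers_necessary:
  assumes rec: "cmp_recovers P A (pair z1 z2)" and nz: "z1 \<noteq> 0" "z2 \<noteq> 0"
  defines "y \<equiv> A *v pair z1 z2"
  shows "l \<notin> {i1, i2} \<Longrightarrow> gain y l < max (gain y i1) (gain y i2)"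
    and "(\<And>k. gain y k \<le> gain y j) \<Longrightarrow> l \<notin> {i1, i2} \<Longrightarrow>
      gain (resid y j) l < max (gain (resid y j) i1) (gain (resid y j) i2)"
    and "restricted_minimizers P A y {i1, i2} = {pair z1 z2}"
proof -
  \<comment> \<open>Even a claim about one choice is drawn from a complete two-step prefix;
    maximizers that fill it exist by finiteness.\<close>
  have argmax: "\<exists>k. \<forall>l. h l \<le> h k" for h :: "'n \<Rightarrow> real"
    using ex_is_arg_min_if_finite[of UNIV "\<lambda>l. - h l"] by (auto simp: is_arg_min_linorder)
  have card: "card (supp (pair z1 z2)) = 2"
    using nz distinct by (simp add: supp_pair)
  note first_two = cmp_recovers_first_two[OF rec card unit, folded y_def,
      unfolded first_choice_iff second_choice_iff supp_pair[OF nz]]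
  have "\<forall>k. (\<forall>l. gain y l \<le> gain y k) \<longrightarrow> k \<in> {i1, i2}"
    using first_two(1) argmax by blast
  then show "l \<notin> {i1, i2} \<Longrightarrow> gain y l < max (gain y i1) (gain y i2)"
    unfolding argmax_in_pair_iff by blast
  show "gain (resid y j) l < max (gain (resid y j) i1) (gain (resid y j) i2)"
    if "\<And>k. gain y k \<le> gain y j" "l \<notin> {i1, i2}"
  proof -
    have "\<forall>k. (\<forall>l. gain (resid y j) l \<le> gain (resid y j) k) \<longrightarrow> k \<in> {i1, i2}"
      using first_two(2) that(1) by blast
    then show ?thesis
      using that(2) unfolding argmax_in_pair_iff by blast
  qed
  show "restricted_minimizers P A y {i1, i2} = {pair z1 z2}"
    using first_two(3) argmax by blast
qed

text \<open>The objective is 0 at \<open>pair z1 z2\<close>, so every minimizer has the same image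
  under \<open>A\<close>, and full column rank identifies the two.\<close>

lemma restricted_minimizers_pair:
  assumes rank: "rank (column_pair A i1 i2) = 2" and "0 \<le> z2"
  shows "restricted_minimizers P A (A *v pair z1 z2) {i1, i2} = {pair z1 z2}"
proof -
  have inj: "w = pair z1 z2" if "supp w \<subseteq> {i1, i2}" and eq: "A *v w = A *v pair z1 z2" for w
  proof -
    have mult: "column_pair A i1 i2 *v vector [v1, v2] = A *v pair v1 v2" for v1 v2
      unfolding matrix_mult_pair
      by (simp add: vec_eq_iff matrix_vector_mult_def column_pair_def column_def sum_2)
    have "column_pair A i1 i2 *v vector [w $ i1, w $ i2] = column_pair A i1 i2 *v vector [z1, z2]"
      using eq unfolding mult by (simp flip: eq_pair[OF that(1)])
    moreover have "inj ((*v) (column_pair A i1 i2))"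
      using full_rank_injective[of "column_pair A i1 i2"] rank by simp
    ultimately have "(vector [w $ i1, w $ i2] :: real ^ 2) = vector [z1, z2]"
      by (rule injD[rotated])
    then have "w $ i1 = z1" "w $ i2 = z2"
      by (auto simp: vec_eq_iff forall_2)
    then show ?thesis
      using eq_pair[OF that(1)] by simp
  qed
  have feasible: "pair z1 z2 \<in> P" "supp (pair z1 z2) \<subseteq> {i1, i2}"
    using assms(2) pair_in_orthant supp_pair_subset by auto
  show ?thesis
  proof (intro equalityI subsetI)
    fix w
    assume "w \<in> restricted_minimizers P A (A *v pair z1 z2) {i1, i2}"
    then have "supp w \<subseteq> {i1, i2}" "(norm (A *v w - A *v pair z1 z2))\<^sup>2 \<le> 0"
      using feasible by (force simp: restricted_minimizers_def is_arg_min_linorder)+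
    then show "w \<in> {pair z1 z2}"
      using inj by simp
  qed (use feasible in \<open>auto simp: restricted_minimizers_def is_arg_min_linorder\<close>)
qed

lemma recovers_sufficient:
  assumes rank: "rank (column_pair A i1 i2) = 2" and nz: "z1 \<noteq> 0" "0 < z2"
  defines "y \<equiv> A *v pair z1 z2"
  assumes first: "\<And>j. (\<And>k. gain y k \<le> gain y j) \<Longrightarrow> j \<in> {i1, i2}"
    and second: "\<And>j k. (\<And>k. gain y k \<le> gain y j) \<Longrightarrow>
      (\<And>l. gain (resid y j) l \<le> gain (resid y j) k) \<Longrightarrow> k \<in> {i1, i2} - {j}"
  shows "cmp_recovers P A (pair z1 z2)"
  unfolding cmp_recovers_def y_def[symmetric]
proof (intro allI impI)
  fix x J
  assume run: "cmp_run P A y x J"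
  have supp: "supp (pair z1 z2) = {i1, i2}"
    using nz supp_pair by simp
  from run have "x 0 = 0" "J 0 = {}"
    by (auto simp: cmp_run_def)
  moreover from run obtain j where "is_arg_min (coord_opt P A y (x 0)) (\<lambda>_. True) j"
    and "J (Suc 0) = J 0 \<union> {j}" and "x (Suc 0) \<in> restricted_minimizers P A y (J (Suc 0))"
    unfolding cmp_run_def by blast
  ultimately have j: "\<And>k. gain y k \<le> gain y j" and J1: "J (Suc 0) = {j}"
    and x1: "x (Suc 0) = axis_coeff Ip A y j *\<^sub>R axis j 1"
    using unit by (auto simp: first_choice_iff restricted_minimizers_singleton)
  from run obtain k where "is_arg_min (coord_opt P A y (x (Suc 0))) (\<lambda>_. True) k"
    and "J (Suc (Suc 0)) = {j} \<union> {k}"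
    unfolding cmp_run_def J1[symmetric] by blast
  then have "J (Suc (Suc 0)) = {i1, i2}"
    using second[OF j] first[OF j] unfolding x1 second_choice_iff by blast
  moreover have "restricted_minimizers P A y {i1, i2} = {pair z1 z2}"
    unfolding y_def using rank nz by (intro restricted_minimizers_pair) auto
  \<comment> \<open>The set may persist beyond step two, so every such \<open>s\<close> is treated;
    \<open>s = 0\<close> is impossible because \<open>J 0\<close> is empty.\<close>
  moreover have "x s \<in> restricted_minimizers P A y {i1, i2}" if "J s = {i1, i2}" for s
    using run that unfolding cmp_run_def by (cases s) (auto, metis)
  ultimately show "(\<exists>s. J s = supp (pair z1 z2)) \<and>
      (\<forall>s. J s = supp (pair z1 z2) \<longrightarrow> restricted_minimizers P A y (J s) = {pair z1 z2} \<and> x s = pair z1 z2)"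
    unfolding supp by auto
qed

section \<open>Residuals and gains in terms of inner products of columns\<close>

lemma resid_i1: "resid (A *v pair z1 z2) i1 = z2 *\<^sub>R (a i2 - \<theta> i1 i2 *\<^sub>R a i1)"
  using i1 by (simp add: resid_def axis_coeff_def matrix_mult_pair inner_add_left inner_column_self
      column_product_def inner_commute algebra_simps)

text \<open>The hypothesis says that the coefficient at \<open>i2\<close> is not clipped; the full
  projection onto that column is then removed.\<close>

lemma resid_i2:
  assumes "0 \<le> \<theta> i1 i2 * z1 + z2"
  shows "resid (A *v pair z1 z2) i2 = z1 *\<^sub>R (a i1 - \<theta> i1 i2 *\<^sub>R a i2)"
  using i2 assms by (simp add: resid_def axis_coeff_def matrix_mult_pair inner_add_left
      inner_column_self column_product_def inner_commute algebra_simps)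

lemma inner_matrix_mult_pair: "(A *v pair z1 z2) \<bullet> a j = \<theta> j i1 * z1 + \<theta> j i2 * z2"
  by (simp add: matrix_mult_pair inner_add_left column_product_def inner_commute algebra_simps)

lemma inner_orth1: "(a i2 - \<theta> i1 i2 *\<^sub>R a i1) \<bullet> a j = \<theta> j i2 - \<theta> i1 i2 * \<theta> j i1"
  and inner_orth2: "(a i1 - \<theta> i1 i2 *\<^sub>R a i2) \<bullet> a j = \<theta> j i1 - \<theta> i1 i2 * \<theta> j i2"
  by (simp_all add: inner_diff_left column_product_def inner_commute[of "a j"])

lemma \<theta>_self: "\<theta> j j = 1" and \<theta>_sym: "\<theta> j k = \<theta> k j"
  by (simp_all add: column_product_def inner_column_self inner_commute)

lemma gain_pair_i1: "gain (A *v pair z1 z2) i1 = \<bar>z1 + \<theta> i1 i2 * z2\<bar>"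
  and gain_pair_i2: "gain (A *v pair z1 z2) i2 = max (\<theta> i1 i2 * z1 + z2) 0"
  using i1 i2 \<theta>_sym[of i2 i1] by (simp_all add: gain_eq inner_matrix_mult_pair \<theta>_self)

lemma gain_orth1:
  assumes "\<bar>\<theta> i1 i2\<bar> < 1"
  shows "gain (a i2 - \<theta> i1 i2 *\<^sub>R a i1) i1 = 0"
    and "gain (a i2 - \<theta> i1 i2 *\<^sub>R a i1) i2 = 1 - (\<theta> i1 i2)\<^sup>2"
proof -
  have "(\<theta> i1 i2)\<^sup>2 < 1"
    using assms by (simp add: abs_square_less_1)
  then show "gain (a i2 - \<theta> i1 i2 *\<^sub>R a i1) i1 = 0"
    and "gain (a i2 - \<theta> i1 i2 *\<^sub>R a i1) i2 = 1 - (\<theta> i1 i2)\<^sup>2"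
    using i1 i2 \<theta>_sym[of i2 i1]
    by (simp_all add: gain_eq inner_orth1 \<theta>_self power2_eq_square)
qed

text \<open>The factor \<open>c\<close> stays inside because it will be \<open>z1\<close>, of either
  sign, while \<open>gain\<close> is only positively homogeneous.\<close>

lemma gain_scaled_orth2:
  assumes "\<bar>\<theta> i1 i2\<bar> < 1"
  shows "gain (c *\<^sub>R (a i1 - \<theta> i1 i2 *\<^sub>R a i2)) i1 = \<bar>c\<bar> * (1 - (\<theta> i1 i2)\<^sup>2)"
    and "gain (c *\<^sub>R (a i1 - \<theta> i1 i2 *\<^sub>R a i2)) i2 = 0"
proof -
  have "(\<theta> i1 i2)\<^sup>2 < 1"
    using assms by (simp add: abs_square_less_1)
  then show "gain (c *\<^sub>R (a i1 - \<theta> i1 i2 *\<^sub>R a i2)) i1 = \<bar>c\<bar> * (1 - (\<theta> i1 i2)\<^sup>2)"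
    and "gain (c *\<^sub>R (a i1 - \<theta> i1 i2 *\<^sub>R a i2)) i2 = 0"
    using i1 i2 \<theta>_sym[of i2 i1]
    by (simp_all add: gain_eq inner_orth2 \<theta>_self power2_eq_square abs_mult)
qed

section \<open>Sufficiency and necessity of the three conditions\<close>

definition selection_condition :: bool where
  "selection_condition \<longleftrightarrow> (\<forall>z1 z2. z1 \<noteq> 0 \<longrightarrow> 0 < z2 \<longrightarrow> (\<forall>j\<in>- {i1, i2}.
     gain (A *v pair z1 z2) j < max (gain (A *v pair z1 z2) i1) (gain (A *v pair z1 z2) i2)))"

text \<open>The second residual carries the factor \<open>z1\<close> of either sign, hence an
  absolute value even on nonnegative coordinates; the factor \<open>z2\<close> of the first is
  positive, so \<open>gain\<close> remains there.\<close>

definition residual_condition :: bool where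
  "residual_condition \<longleftrightarrow> (\<forall>j\<in>- {i1, i2}.
     gain (a i2 - \<theta> i1 i2 *\<^sub>R a i1) j < 1 - (\<theta> i1 i2)\<^sup>2 \<and>
     \<bar>(a i1 - \<theta> i1 i2 *\<^sub>R a i2) \<bullet> a j\<bar> < 1 - (\<theta> i1 i2)\<^sup>2)"

lemma conditions_sufficient:
  assumes rank: "rank (column_pair A i1 i2) = 2" and sel: selection_condition and res: residual_condition
    and third: "- {i1, i2} \<noteq> {}" and nz: "z1 \<noteq> 0" "0 < z2"
  shows "cmp_recovers P A (pair z1 z2)"
proof -
  define y where "y = A *v pair z1 z2"
  have \<theta>: "\<bar>\<theta> i1 i2\<bar> < 1"
    using rank unit by (simp add: rank_column_pair_iff)
  then have pos: "0 < 1 - (\<theta> i1 i2)\<^sup>2"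
    by (simp add: abs_square_less_1)
  have sel_y: "gain y j < max (gain y i1) (gain y i2)" if "j \<in> - {i1, i2}" for j
    using sel nz that unfolding selection_condition_def y_def by blast
  have first: "j \<in> {i1, i2}" if "\<And>k. gain y k \<le> gain y j" for j
    using that sel_y argmax_in_pair_iff[of "gain y" i1 i2] by blast
  have second: "k \<in> {i1, i2} - {j}"
    if j: "\<And>k. gain y k \<le> gain y j" and k: "\<And>l. gain (resid y j) l \<le> gain (resid y j) k" for j k
  proof -
    consider "j = i1" | "j = i2"
      using first[OF j] by blast
    then show ?thesis
    proof cases
      case 1
      let ?r = "a i2 - \<theta> i1 i2 *\<^sub>R a i1"
      have "gain ?r i2 \<le> gain ?r k"
        using k[of i2] nz(2) by (simp add: 1 y_def resid_i1 gain_scaleR)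
      moreover have "gain ?r l < gain ?r i2" if "l \<in> - {i2}" for l
        using res that gain_orth1[OF \<theta>] pos unfolding residual_condition_def by (cases "l = i1") auto
      ultimately show ?thesis
        using 1 distinct by force
    next
      case 2
      \<comment> \<open>If \<open>i2\<close> won with gain 0, both gains in the pair would be 0 and
        could not strictly exceed the nonnegative gain of a third index. Positivity means that the
        coefficient is unclipped.\<close>
      have "0 < gain y i2"
      proof (rule ccontr)
        assume "\<not> 0 < gain y i2"
        then have "max (gain y i1) (gain y i2) \<le> 0"
          using j[of i1] 2 by simp
        moreover obtain l where "l \<in> - {i1, i2}"
          using third by blast
        ultimately show False
          using sel_y[of l] gain_nonneg[of y l] by linarith
      qed
      then have "0 \<le> \<theta> i1 i2 * z1 + z2"
        by (simp add: y_def gain_pair_i2)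
      note r = resid_i2[OF this, folded y_def]
      have "gain (resid y i2) l < gain (resid y i2) i1" if "l \<in> - {i1}" for l
      proof (cases "l = i2")
        case True
        then show ?thesis
          using nz(1) pos by (simp add: r gain_scaled_orth2[OF \<theta>])
      next
        case False
        then have "\<bar>z1\<bar> * \<bar>(a i1 - \<theta> i1 i2 *\<^sub>R a i2) \<bullet> a l\<bar> < \<bar>z1\<bar> * (1 - (\<theta> i1 i2)\<^sup>2)"
          using that res nz(1) unfolding residual_condition_def by (intro mult_strict_left_mono) auto
        then show ?thesis
          using gain_le[of "resid y i2" l] by (simp add: r gain_scaled_orth2[OF \<theta>] abs_mult)
      qed
      moreover have "gain (resid y i2) i1 \<le> gain (resid y i2) k"
        using k[of i1] 2 by simp
      ultimately show ?thesis
        using 2 distinct by force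
    qed
  qed
  show ?thesis
    using rank nz first second unfolding y_def by (rule recovers_sufficient)
qed

lemma conditions_necessary:
  assumes rec: "\<And>z1 z2. z1 \<noteq> 0 \<Longrightarrow> 0 < z2 \<Longrightarrow> cmp_recovers P A (pair z1 z2)"
  shows "rank (column_pair A i1 i2) = 2" and selection_condition and residual_condition
proof -
  define t where "t = \<theta> i1 i2"
  have "\<bar>t\<bar> \<le> 1"
    using Cauchy_Schwarz_ineq2[of "a i1" "a i2"] unit by (simp add: t_def column_product_def)
  have \<theta>: "\<bar>t\<bar> < 1"
  proof (rule ccontr)
    assume "\<not> \<bar>t\<bar> < 1"
    with \<open>\<bar>t\<bar> \<le> 1\<close> have "t\<^sup>2 = 1"
      by (simp add: abs_square_eq_1)
    then have "(a i2 - t *\<^sub>R a i1) \<bullet> (a i2 - t *\<^sub>R a i1) = 0"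
      by (simp add: inner_diff inner_column_self inner_commute t_def column_product_def
          power2_eq_square)
    then have "a i2 = t *\<^sub>R a i1"
      by (simp only: inner_eq_zero_iff right_minus_eq)
    \<comment> \<open>Dependent columns allow the whole weight to move to the free index
      \<open>i1\<close>, which gives a second feasible exact solution.\<close>
    then have "A *v pair (1 + t) 0 = A *v pair 1 1"
      by (simp add: matrix_mult_pair scaleR_left_distrib)
    then have "pair (1 + t) 0 \<in> restricted_minimizers P A (A *v pair 1 1) {i1, i2}"
      using pair_in_orthant supp_pair_subset by (simp add: restricted_minimizers_def is_arg_min_linorder)
    then have "pair (1 + t) 0 = pair 1 1"
      using recovers_necessary(3)[OF rec] by simp
    then show False
      using distinct by (auto simp: vec_eq_iff pair_nth split: if_splits)
  qed
  then show "rank (column_pair A i1 i2) = 2"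
    using unit by (simp add: rank_column_pair_iff t_def)
  show sel: selection_condition
    unfolding selection_condition_def using recovers_necessary(1)[OF rec] by simp
  \<comment> \<open>A ratio of the two entries this large forces the first choice to be the dominant index.\<close>
  define M where "M = 2 / (1 - \<bar>t\<bar>)"
  have M: "M - \<bar>t\<bar> * M = 2" "0 < M"
  proof -
    have "M * (1 - \<bar>t\<bar>) = 2"
      using M_def \<theta> by (subst (asm) nonzero_eq_divide_eq) auto
    then show "M - \<bar>t\<bar> * M = 2"
      by (simp add: algebra_simps)
    show "0 < M"
      using \<theta> by (simp add: M_def)
  qed
  have t1: "\<bar>t * z\<bar> \<le> \<bar>t\<bar>" if "\<bar>z\<bar> = 1" for z
    using that by (simp add: abs_mult)
  \<comment> \<open>The numerator 2 in \<open>M\<close> leaves the dominated index a gain of at most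
    \<open>M - 1\<close>, below the lower bound \<open>M - \<bar>t\<bar>\<close> for the dominant
    one.\<close>
  have tM: "\<bar>t * M\<bar> = M - 2"
    using M by (simp add: abs_mult)
  \<comment> \<open>By \<open>sel\<close>, an index of the pair that wins within the pair wins
    globally.\<close>
  have choice: "gain (A *v pair z1 z2) k \<le> gain (A *v pair z1 z2) i"
    if "z1 \<noteq> 0" "0 < z2" "i \<in> {i1, i2}" "gain (A *v pair z1 z2) i1 \<le> gain (A *v pair z1 z2) i"
      "gain (A *v pair z1 z2) i2 \<le> gain (A *v pair z1 z2) i" for z1 z2 i k
  proof (cases "k \<in> {i1, i2}")
    case True
    then show ?thesis
      using that(4,5) by blast
  next
    case False
    then have "gain (A *v pair z1 z2) k < max (gain (A *v pair z1 z2) i1) (gain (A *v pair z1 z2) i2)"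
      using sel that(1,2) unfolding selection_condition_def by blast
    then show ?thesis
      using that(4,5) by linarith
  qed
  show residual_condition
    unfolding residual_condition_def
  proof (intro ballI conjI)
    fix j
    assume j: "j \<in> - {i1, i2}"
    \<comment> \<open>Here \<open>i1\<close> is chosen first, and since the second entry is 1 the
      residual is exactly the vector in the claim.\<close>
    have "gain (A *v pair M 1) i2 \<le> gain (A *v pair M 1) i1"
      unfolding gain_pair_i1 gain_pair_i2 t_def[symmetric] using t1[of 1] tM \<theta> M by linarith
    then have "gain (A *v pair M 1) k \<le> gain (A *v pair M 1) i1" for k
      using choice[of M 1 i1 k] M(2) by simp
    then have "gain (resid (A *v pair M 1) i1) j <
        max (gain (resid (A *v pair M 1) i1) i1) (gain (resid (A *v pair M 1) i1) i2)"
      using M(2) j by (intro recovers_necessary(2) rec) simp_all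
    then show "gain (a i2 - \<theta> i1 i2 *\<^sub>R a i1) j < 1 - (\<theta> i1 i2)\<^sup>2"
      using \<theta> by (simp add: resid_i1 gain_orth1 t_def abs_square_le_1 max_def)
    have "gain (z *\<^sub>R (a i1 - \<theta> i1 i2 *\<^sub>R a i2)) j < 1 - (\<theta> i1 i2)\<^sup>2" if z: "\<bar>z\<bar> = 1" for z
    proof -
      have ge: "0 \<le> t * z + M"
        using t1[OF z] tM M \<theta> by linarith
      have "gain (A *v pair z M) i1 \<le> gain (A *v pair z M) i2"
        unfolding gain_pair_i1 gain_pair_i2 t_def[symmetric] using t1[OF z] tM \<theta> M z by linarith
      then have "gain (A *v pair z M) k \<le> gain (A *v pair z M) i2" for k
        using choice[of z M i2 k] M(2) z by fastforce
      then have "gain (resid (A *v pair z M) i2) j <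
          max (gain (resid (A *v pair z M) i2) i1) (gain (resid (A *v pair z M) i2) i2)"
        using M(2) j z by (intro recovers_necessary(2) rec) auto
      moreover have "resid (A *v pair z M) i2 = z *\<^sub>R (a i1 - \<theta> i1 i2 *\<^sub>R a i2)"
        using ge by (simp add: resid_i2 t_def)
      moreover have "t\<^sup>2 < 1"
        using \<theta> by (simp add: abs_square_less_1)
      ultimately show ?thesis
        using \<theta> z by (simp add: gain_scaled_orth2 t_def)
    qed
    \<comment> \<open>On a nonnegative coordinate each sign bounds only one positive part; together
      they bound the absolute value.\<close>
    from this[of 1] this[of "- 1"] show "\<bar>(a i1 - \<theta> i1 i2 *\<^sub>R a i2) \<bullet> a j\<bar> < 1 - (\<theta> i1 i2)\<^sup>2"
      by (simp add: gain_eq inner_diff_left abs_less_iff split: if_splits)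
  qed
qed

end

section \<open>Translation into the stated inequalities\<close>

theorem theorem5p6:
  fixes A :: "real ^ 'n ^ 'm"
    and I1 Ip :: "'n set"
    and i1 i2 :: 'n
  defines "P \<equiv> partial_orthant Ip"
    and "\<theta> \<equiv> column_product A"
    and "Sc \<equiv> - {i1, i2}"
  assumes "I1 \<noteq> {}" and "Ip \<noteq> {}"
    and "I1 \<inter> Ip = {}" and "I1 \<union> Ip = UNIV"
    and "CARD('n) \<ge> 3"
    and "\<And>i. norm (column i A) = 1"
    and "i1 \<in> I1" and "i2 \<in> Ip"
  shows
    "((\<forall>x\<in>P. supp x = {i1, i2} \<longrightarrow> cmp_recovers P A x) \<longleftrightarrow>
       rank (column_pair A i1 i2) = 2 \<and>
       (\<forall>z1 z2. z1 \<noteq> 0 \<and> z2 > 0 \<longrightarrow>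
          max \<bar>z1 + \<theta> i1 i2 * z2\<bar> (max (\<theta> i1 i2 * z1 + z2) 0) >
          Max_of_Maxes
            {{\<bar>\<theta> j i1 * z1 + \<theta> j i2 * z2\<bar> | j. j \<in> Sc \<inter> I1},
             {max (\<theta> j i1 * z1 + \<theta> j i2 * z2) 0 | j. j \<in> Sc \<inter> Ip}}) \<and>
       1 - (\<theta> i1 i2)\<^sup>2 >
         Max_of_Maxes
           {{\<bar>\<theta> j i2 - \<theta> i1 i2 * \<theta> j i1\<bar> | j. j \<in> Sc \<inter> I1},
            {max (\<theta> j i2 - \<theta> i1 i2 * \<theta> j i1) 0 | j. j \<in> Sc \<inter> Ip},
            {\<bar>\<theta> j i1 - \<theta> i1 i2 * \<theta> j i2\<bar> | j. j \<in> Sc}}) \<and>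
     (rank (column_pair A i1 i2) = 2 \<longleftrightarrow> \<bar>\<theta> i1 i2\<bar> < 1)"
proof -
  have i1: "i1 \<notin> Ip" and i2: "i2 \<in> Ip" and I1: "I1 = - Ip"
    using assms by auto
  interpret support_pair A Ip i1 i2
    using assms(9) i1 i2 by unfold_locales
  \<comment> \<open>A third index makes some family in each maximum nonempty, and it also enters the
    sufficiency proof.\<close>
  have "card {i1, i2} < CARD('n)"
    using assms(8) distinct by simp
  then have "{i1, i2} \<noteq> UNIV"
    by (metis less_irrefl)
  then have third: "- {i1, i2} \<noteq> {}"
    by auto
  have sel: "(\<forall>z1 z2. z1 \<noteq> 0 \<and> z2 > 0 \<longrightarrow>
          max \<bar>z1 + \<theta> i1 i2 * z2\<bar> (max (\<theta> i1 i2 * z1 + z2) 0) >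
          Max_of_Maxes
            {{\<bar>\<theta> j i1 * z1 + \<theta> j i2 * z2\<bar> | j. j \<in> Sc \<inter> I1},
             {max (\<theta> j i1 * z1 + \<theta> j i2 * z2) 0 | j. j \<in> Sc \<inter> Ip}}) \<longleftrightarrow> selection_condition"
  proof -
    have eq: "Max_of_Maxes
            {{\<bar>\<theta> j i1 * z1 + \<theta> j i2 * z2\<bar> | j. j \<in> Sc \<inter> I1},
             {max (\<theta> j i1 * z1 + \<theta> j i2 * z2) 0 | j. j \<in> Sc \<inter> Ip}} < c \<longleftrightarrow>
        (\<forall>j\<in>- {i1, i2}. gain (A *v pair z1 z2) j < c)" for z1 z2 c
      by (subst Max_of_Maxes_less_iff)
        (use third in \<open>auto simp: gain_eq inner_matrix_mult_pair Sc_def I1 \<theta>_def\<close>)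
    show ?thesis
      unfolding eq unfolding selection_condition_def gain_pair_i1 gain_pair_i2 \<theta>_def
      by (simp only: imp_conjL)
  qed
  have res: "1 - (\<theta> i1 i2)\<^sup>2 >
         Max_of_Maxes
           {{\<bar>\<theta> j i2 - \<theta> i1 i2 * \<theta> j i1\<bar> | j. j \<in> Sc \<inter> I1},
            {max (\<theta> j i2 - \<theta> i1 i2 * \<theta> j i1) 0 | j. j \<in> Sc \<inter> Ip},
            {\<bar>\<theta> j i1 - \<theta> i1 i2 * \<theta> j i2\<bar> | j. j \<in> Sc}} \<longleftrightarrow> residual_condition"
  proof (subst Max_of_Maxes_less_iff)
    let ?c = "1 - (\<theta> i1 i2)\<^sup>2"
    \<comment> \<open>Distributes the case distinction inside \<open>gain\<close> over the three
      index families of (iii).\<close>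
    have split: "(\<forall>j\<in>S. (if j \<in> Ip then f j else g j) < c \<and> h j < c) \<longleftrightarrow>
        (\<forall>j\<in>S \<inter> - Ip. g j < c) \<and> (\<forall>j\<in>S \<inter> Ip. f j < c) \<and> (\<forall>j\<in>S. h j < c)"
      for S c and f g h :: "'n \<Rightarrow> real"
      by auto
    have "residual_condition \<longleftrightarrow> (\<forall>j\<in>Sc.
        (if j \<in> Ip then max (\<theta> j i2 - \<theta> i1 i2 * \<theta> j i1) 0 else \<bar>\<theta> j i2 - \<theta> i1 i2 * \<theta> j i1\<bar>) < ?c \<and>
        \<bar>\<theta> j i1 - \<theta> i1 i2 * \<theta> j i2\<bar> < ?c)"
      unfolding residual_condition_def gain_eq inner_orth1 inner_orth2 Sc_def \<theta>_def ..
    also have "\<dots> \<longleftrightarrow> (\<forall>j\<in>Sc \<inter> I1. \<bar>\<theta> j i2 - \<theta> i1 i2 * \<theta> j i1\<bar> < ?c) \<and>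
        (\<forall>j\<in>Sc \<inter> Ip. max (\<theta> j i2 - \<theta> i1 i2 * \<theta> j i1) 0 < ?c) \<and>
        (\<forall>j\<in>Sc. \<bar>\<theta> j i1 - \<theta> i1 i2 * \<theta> j i2\<bar> < ?c)"
      unfolding I1 by (rule split)
    finally show "(\<forall>X\<in>{{\<bar>\<theta> j i2 - \<theta> i1 i2 * \<theta> j i1\<bar> | j. j \<in> Sc \<inter> I1},
            {max (\<theta> j i2 - \<theta> i1 i2 * \<theta> j i1) 0 | j. j \<in> Sc \<inter> Ip},
            {\<bar>\<theta> j i1 - \<theta> i1 i2 * \<theta> j i2\<bar> | j. j \<in> Sc}}. \<forall>v\<in>X. v < ?c) \<longleftrightarrow> residual_condition"
      unfolding Setcompr_eq_image by (simp only: ball_simps simp_thms)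
  qed (use third in \<open>auto simp: Sc_def\<close>)
  have pairs: "(\<forall>x\<in>P. supp x = {i1, i2} \<longrightarrow> cmp_recovers P A x) \<longleftrightarrow>
      (\<forall>z1 z2. z1 \<noteq> 0 \<longrightarrow> 0 < z2 \<longrightarrow> cmp_recovers P A (pair z1 z2))"
  proof (intro iffI ballI allI impI)
    fix x
    assume "\<forall>z1 z2. z1 \<noteq> 0 \<longrightarrow> 0 < z2 \<longrightarrow> cmp_recovers P A (pair z1 z2)"
      and x: "x \<in> P" "supp x = {i1, i2}"
    moreover have "x $ i1 \<noteq> 0" "0 < x $ i2"
      using x i2 by (auto simp: P_def partial_orthant_def supp_def less_le)
    ultimately have "cmp_recovers P A (pair (x $ i1) (x $ i2))"
      by blast
    then show "cmp_recovers P A x"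
      using eq_pair[of x] x by simp
  qed (simp add: P_def pair_in_orthant supp_pair)
  have "(\<forall>z1 z2. z1 \<noteq> 0 \<longrightarrow> 0 < z2 \<longrightarrow> cmp_recovers P A (pair z1 z2)) \<longleftrightarrow>
      rank (column_pair A i1 i2) = 2 \<and> selection_condition \<and> residual_condition"
  proof (intro iffI conjI allI impI)
    assume "\<forall>z1 z2. z1 \<noteq> 0 \<longrightarrow> 0 < z2 \<longrightarrow> cmp_recovers P A (pair z1 z2)"
    then have "\<And>z1 z2. z1 \<noteq> 0 \<Longrightarrow> 0 < z2 \<Longrightarrow> cmp_recovers (partial_orthant Ip) A (pair z1 z2)"
      by (simp add: P_def)
    from conditions_necessary[OF this]
    show "rank (column_pair A i1 i2) = 2" selection_condition residual_condition
      by simp_all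
  next
    fix z1 z2 :: real
    assume "rank (column_pair A i1 i2) = 2 \<and> selection_condition \<and> residual_condition"
      and "z1 \<noteq> 0" "0 < z2"
    then show "cmp_recovers P A (pair z1 z2)"
      unfolding P_def using third by (intro conditions_sufficient) simp_all
  qed
  then show ?thesis
    unfolding sel res pairs using rank_column_pair_iff[OF unit unit] by (simp add: \<theta>_def)
qed

end
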